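(* The main Seidel eigenvalues of a hyperstar $S_n^k$ are $r_1$ and $r_2$, which are the roots of the equation $$\lambda^2-((k-1)(n-3)+1)\lambda-(n-1)(k-1)=0.$$
   Context: A hypergraph $G^*=(V,E)$ has a finite vertex set $V=\{v_1,\dots,v_N\}$ and a finite set $E$ of hyperedges, each a subset of $V$. Its adjacency matrix $A=(a_{ij})$ has $a_{ij}=|\{e\in E:\{v_i,v_j\}\subset e\}|$ for $i\ne j$ and $a_{ii}=0$. Its Seidel matrix is $S=J_N-I_N-2A$, where $J_N$ is the all-ones matrix and $I_N$ the identity matrix of order $N$. An eigenvalue of $S$ is called a main Seidel eigenvalue of $G^*$ if its eigenspace is not orthogonal to the all-ones vector $\mathbf{j}$, i.e. it has an eigenvector whose entries have nonzero sum. For $k\ge 2$, the hyperstar $S_n^k$ is the $k$-uniform hypergraph obtained from the star $S_n$ on $n$ vertices by adding $k-2$ new vertices to each edge: it has the $(n-1)(k-1)+1$ vertices $v_{0,0}$ and $v_{i,j}$ ($1\le i\le n-1$, $1\le j\le k-1$), and the $n-1$ hyperedges $\{v_{0,0},v_{i,1},\dots,v_{i,k-1}\}$, $1\le i\le n-1$.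
   Formalization: The formal theorem assumes n ≥ 3; for n = 2 the only main Seidel eigenvalue is 1−k although 1 is also a root, and for n = 1 the only one is 0 although 3−2k is also a root, so the claim fails there. *)

theory Defs
  imports "Jordan_Normal_Form.Char_Poly"
begin

record 'a hypergraph =
  verts :: "'a set"
  edges :: "'a set set"

definition finite_hypergraph :: "'a hypergraph \<Rightarrow> bool" where
  "finite_hypergraph H \<longleftrightarrow> finite (verts H) \<and> edges H \<subseteq> Pow (verts H)"

definition uniform :: "nat \<Rightarrow> 'a hypergraph \<Rightarrow> bool" where
  "uniform k H \<longleftrightarrow> (\<forall>e\<in>edges H. card e = k)"

text \<open>Matrices are indexed by positions, so they are taken relative to an enumeration
  \<open>vs = [v\<^sub>1, \<dots>, v\<^sub>N]\<close> of the vertex set.\<close>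

definition enumerates :: "'a list \<Rightarrow> 'a hypergraph \<Rightarrow> bool" where
  "enumerates vs H \<longleftrightarrow> distinct vs \<and> set vs = verts H"

text \<open>The inclusion in the adjacency count is not strict, so that ordinary graphs
  (edges of size 2) get their usual adjacency matrix.\<close>

definition adjacency_matrix :: "'a hypergraph \<Rightarrow> 'a list \<Rightarrow> real mat" where
  "adjacency_matrix H vs = mat (length vs) (length vs)
     (\<lambda>(i, j). if i = j then 0 else real (card {e \<in> edges H. {vs ! i, vs ! j} \<subseteq> e}))"

definition seidel_matrix :: "'a hypergraph \<Rightarrow> 'a list \<Rightarrow> real mat" where
  "seidel_matrix H vs =
     mat (length vs) (length vs) (\<lambda>_. 1) - 1\<^sub>m (length vs) - 2 \<cdot>\<^sub>m adjacency_matrix H vs"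

text \<open>The Seidel matrix is real symmetric, so real eigenvalues and eigenvectors suffice.\<close>

definition main_seidel_eigenvalue :: "'a hypergraph \<Rightarrow> 'a list \<Rightarrow> real \<Rightarrow> bool" where
  "main_seidel_eigenvalue H vs x \<longleftrightarrow>
     (\<exists>v. eigenvector (seidel_matrix H vs) v x \<and> v \<bullet> vec (length vs) (\<lambda>_. 1) \<noteq> 0)"

text \<open>The pair \<open>(i, j)\<close> is the vertex \<open>v\<^bsub>i,j\<^esub>\<close>; \<open>n\<close> counts the vertices of the
  underlying star, so there are \<open>n - 1\<close> hyperedges.\<close>

definition hyperstar :: "nat \<Rightarrow> nat \<Rightarrow> (nat \<times> nat) hypergraph" where
  "hyperstar n k =
     \<lparr>verts = insert (0, 0) ({1..<n} \<times> {1..<k}),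
      edges = (\<lambda>i. insert (0, 0) ({i} \<times> {1..<k})) ` {1..<n}\<rparr>"

lemma finite_hypergraph_hyperstar: "finite_hypergraph (hyperstar n k)"
  by (auto simp: finite_hypergraph_def hyperstar_def)

lemma uniform_hyperstar:
  assumes "k \<ge> 1"
  shows "uniform k (hyperstar n k)"
  using assms by (auto simp: uniform_def hyperstar_def)

lemma card_verts_hyperstar: "card (verts (hyperstar n k)) = (n - 1) * (k - 1) + 1"
  by (simp add: hyperstar_def)

lemma card_edges_hyperstar:
  assumes "k \<ge> 2"
  shows "card (edges (hyperstar n k)) = n - 1"
proof -
  have "inj_on (\<lambda>i::nat. insert (0, 0) ({i} \<times> {1..<k})) {1..<n}"
  proof (rule inj_onI)
    fix i j :: nat
    assume ij: "i \<in> {1..<n}" "j \<in> {1..<n}"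
      and eq: "insert (0, 0) ({i} \<times> {1..<k}) = insert (0, 0) ({j} \<times> {1..<k})"
    have "(i, 1) \<in> insert (0, 0) ({i} \<times> {1..<k})"
      using assms by simp
    then have "(i, 1) \<in> insert (0, 0) ({j} \<times> {1..<k})"
      by (simp only: eq)
    then show "i = j"
      by simp
  qed
  then show ?thesis
    by (simp add: hyperstar_def card_image)
qed

end

theory Submission
  imports Defs
begin

text \<open>Read an eigenvector as a function \<open>f\<close> on the vertices and let \<open>a\<close> be its value at the
  centre and \<open>B\<close> its sum over the other vertices. The row of the centre gives \<open>\<lambda>a = -B\<close>, and adding
  up the remaining rows gives \<open>\<lambda>B = -(n-1)(k-1)a + ((k-1)(n-3)+1)B\<close>. Hence \<open>a\<close> times the quadratic
  vanishes, and \<open>a = 0\<close> would force \<open>a + B = 0\<close>. Conversely, for a root \<open>\<lambda>\<close> the function with value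
  \<open>-(n-1)(k-1)\<close> at the centre and \<open>\<lambda>\<close> elsewhere is an eigenvector; its sum is nonzero because \<open>1\<close>
  is not a root. The roots are distinct because their product is negative.\<close>

section \<open>Seidel matrices as operators on functions on the vertices\<close>

text \<open>This is \<open>J - I - 2A\<close> without an enumeration of the vertices. The adjacency
  term is grouped by the edges through \<open>u\<close>, so that codegrees need not be computed for
  a concrete hypergraph.\<close>

definition seidel_operator :: "'a hypergraph \<Rightarrow> ('a \<Rightarrow> real) \<Rightarrow> 'a \<Rightarrow> real" where
  "seidel_operator H f u = (\<Sum>w\<in>verts H. f w) - f u
     - 2 * (\<Sum>e | e \<in> edges H \<and> u \<in> e. (\<Sum>w\<in>e. f w) - f u)"

text \<open>Double counting of the pairs of a vertex \<open>w\<close> other than \<open>u\<close>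
  and an edge containing both: grouped by \<open>w\<close> they give the row of \<open>A\<close> at
  \<open>u\<close>, grouped by edges the term in \<open>seidel_operator\<close>.\<close>

lemma sum_codegree:
  assumes "finite_hypergraph H" and "u \<in> verts H"
  shows "(\<Sum>w\<in>verts H. (if u = w then 0 else real (card {e \<in> edges H. {u, w} \<subseteq> e})) * f w)
    = (\<Sum>e | e \<in> edges H \<and> u \<in> e. (\<Sum>w\<in>e. f w) - f u)"
proof -
  have finV: "finite (verts H)" and sub: "\<And>e. e \<in> edges H \<Longrightarrow> e \<subseteq> verts H"
    using assms(1) by (auto simp: finite_hypergraph_def)
  have finE: "finite (edges H)"
    using assms(1) finV by (meson finite_hypergraph_def finite_Pow_iff finite_subset)
  let ?E = "{e \<in> edges H. u \<in> e}"
  have "(\<Sum>w\<in>verts H. (if u = w then 0 else real (card {e \<in> edges H. {u, w} \<subseteq> e})) * f w)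
    = (\<Sum>w\<in>verts H. \<Sum>e\<in>?E. if w \<in> e \<and> w \<noteq> u then f w else 0)"
  proof (rule sum.cong[OF refl])
    fix w
    have "(\<Sum>e\<in>?E. if w \<in> e then f w else 0) = real (card {e \<in> edges H. {u, w} \<subseteq> e}) * f w"
      using finE by (simp add: sum.If_cases Int_def conj_assoc)
    then show "(if u = w then 0 else real (card {e \<in> edges H. {u, w} \<subseteq> e})) * f w
      = (\<Sum>e\<in>?E. if w \<in> e \<and> w \<noteq> u then f w else 0)"
      by (cases "u = w") auto
  qed
  also have "\<dots> = (\<Sum>e\<in>?E. \<Sum>w\<in>verts H. if w \<in> e \<and> w \<noteq> u then f w else 0)"
    by (rule sum.swap)
  also have "\<dots> = (\<Sum>e\<in>?E. (\<Sum>w\<in>e. f w) - f u)"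
  proof (rule sum.cong[OF refl])
    fix e assume e: "e \<in> ?E"
    then have "verts H \<inter> {w. w \<in> e \<and> w \<noteq> u} = e - {u}"
      using sub by blast
    moreover have "finite e"
      using e sub finV finite_subset by blast
    ultimately show "(\<Sum>w\<in>verts H. if w \<in> e \<and> w \<noteq> u then f w else 0) = (\<Sum>w\<in>e. f w) - f u"
      using e finV by (simp add: sum.If_cases sum_diff1)
  qed
  finally show ?thesis .
qed

lemma sum_nth_enumerates:
  assumes "enumerates vs H"
  shows "(\<Sum>j<length vs. g (vs ! j)) = (\<Sum>w\<in>verts H. g w)"
  using assms sum.reindex_bij_betw[OF bij_betw_nth[of vs "{..<length vs}" "set vs"], of g]
  by (simp add: enumerates_def)

lemma seidel_matrix_mult_vec_nth:
  assumes "finite_hypergraph H" and vs: "enumerates vs H" and i: "i < length vs"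
  shows "(seidel_matrix H vs *\<^sub>v vec (length vs) (\<lambda>j. f (vs ! j))) $ i = seidel_operator H f (vs ! i)"
proof -
  let ?u = "vs ! i"
  let ?c = "\<lambda>w. if ?u = w then 0 else real (card {e \<in> edges H. {?u, w} \<subseteq> e})"
  have u: "?u \<in> verts H" and dist: "distinct vs" and finV: "finite (verts H)"
    using vs i assms(1) by (auto simp: enumerates_def finite_hypergraph_def)
  \<comment> \<open>Since \<open>vs\<close> is distinct, \<open>i = j\<close> can be replaced by
    equality of the vertices; each summand then depends on \<open>j\<close> only through
    \<open>vs ! j\<close>.\<close>
  have "(seidel_matrix H vs *\<^sub>v vec (length vs) (\<lambda>j. f (vs ! j))) $ i
    = (\<Sum>j<length vs. (1 - (if ?u = vs ! j then 1 else 0) - 2 * ?c (vs ! j)) * f (vs ! j))"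
    unfolding seidel_matrix_def adjacency_matrix_def using i dist
    by (auto simp: scalar_prod_def nth_eq_iff_index_eq lessThan_atLeast0 intro!: sum.cong)
  also have "\<dots> = (\<Sum>w\<in>verts H. (1 - (if ?u = w then 1 else 0) - 2 * ?c w) * f w)"
    by (rule sum_nth_enumerates[OF vs])
  also have "\<dots> = (\<Sum>w\<in>verts H. f w - (if ?u = w then f w else 0) - 2 * (?c w * f w))"
    by (rule sum.cong) (auto simp: algebra_simps)
  also have "\<dots> = (\<Sum>w\<in>verts H. f w) - f ?u - 2 * (\<Sum>w\<in>verts H. ?c w * f w)"
    using u finV by (simp add: sum_subtractf sum_distrib_left)
  finally show ?thesis
    unfolding seidel_operator_def sum_codegree[OF assms(1) u] .
qed

text \<open>This removes matrices from the rest of the argument. A nonzero sum already makes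
  \<open>f\<close> a nonzero function, so the right side needs no separate condition for
  that.\<close>

lemma main_seidel_eigenvalue_iff:
  assumes H: "finite_hypergraph H" and vs: "enumerates vs H"
  shows "main_seidel_eigenvalue H vs x \<longleftrightarrow>
    (\<exists>f. (\<forall>u\<in>verts H. seidel_operator H f u = x * f u) \<and> (\<Sum>u\<in>verts H. f u) \<noteq> 0)"
proof
  let ?N = "length vs"
  have dim: "dim_row (seidel_matrix H vs) = ?N"
    by (simp add: seidel_matrix_def adjacency_matrix_def)
  have dist: "distinct vs" and set: "set vs = verts H"
    using vs by (auto simp: enumerates_def)
  {
    assume "main_seidel_eigenvalue H vs x"
    then obtain v where ev: "eigenvector (seidel_matrix H vs) v x"
      and nz: "v \<bullet> vec ?N (\<lambda>_. 1) \<noteq> 0"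
      by (auto simp: main_seidel_eigenvalue_def)
    have v: "dim_vec v = ?N"
      using ev dim by (auto simp: eigenvector_def)
    have "bij_betw (\<lambda>j. vs ! j) {..<?N} (verts H)"
      using dist set by (intro bij_betw_nth) auto
    \<comment> \<open>Inverting the enumeration turns a vector into a function on vertices.\<close>
    then obtain idx where idx: "\<And>j. j < ?N \<Longrightarrow> idx (vs ! j) = j"
      by (metis bij_betw_inv_into_left lessThan_iff)
    define f where "f w = v $ idx w" for w
    have v_eq: "v = vec ?N (\<lambda>j. f (vs ! j))"
      using v idx by (auto simp: f_def)
    have "seidel_operator H f u = x * f u" if u: "u \<in> verts H" for u
    proof -
      obtain i where i: "i < ?N" "vs ! i = u"
        using u set by (metis in_set_conv_nth)
      have "seidel_operator H f u = (seidel_matrix H vs *\<^sub>v v) $ i"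
        using seidel_matrix_mult_vec_nth[OF H vs i(1), of f] i(2) v_eq by simp
      also have "\<dots> = (x \<cdot>\<^sub>v v) $ i"
        using ev by (simp add: eigenvector_def)
      also have "\<dots> = x * f u"
        using i v idx by (auto simp: f_def)
      finally show ?thesis .
    qed
    moreover have "v \<bullet> vec ?N (\<lambda>_. 1) = (\<Sum>u\<in>verts H. f u)"
      unfolding sum_nth_enumerates[OF vs, symmetric]
      by (subst v_eq) (simp add: scalar_prod_def lessThan_atLeast0)
    ultimately show "\<exists>f. (\<forall>u\<in>verts H. seidel_operator H f u = x * f u) \<and> (\<Sum>u\<in>verts H. f u) \<noteq> 0"
      using nz by auto
  next
    assume "\<exists>f. (\<forall>u\<in>verts H. seidel_operator H f u = x * f u) \<and> (\<Sum>u\<in>verts H. f u) \<noteq> 0"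
    then obtain f where f: "\<And>u. u \<in> verts H \<Longrightarrow> seidel_operator H f u = x * f u"
      and nz: "(\<Sum>u\<in>verts H. f u) \<noteq> 0"
      by auto
    let ?v = "vec ?N (\<lambda>j. f (vs ! j))"
    have sum: "?v \<bullet> vec ?N (\<lambda>_. 1) = (\<Sum>u\<in>verts H. f u)"
      unfolding sum_nth_enumerates[OF vs, symmetric]
      by (simp add: scalar_prod_def lessThan_atLeast0)
    have "?v \<noteq> 0\<^sub>v ?N"
    proof
      assume "?v = 0\<^sub>v ?N"
      then have "?v \<bullet> vec ?N (\<lambda>_. 1) = 0"
        by (simp add: scalar_prod_def)
      with sum nz show False
        by simp
    qed
    moreover have "seidel_matrix H vs *\<^sub>v ?v = x \<cdot>\<^sub>v ?v"
      using f set[symmetric] dim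
      by (intro eq_vecI) (auto simp del: index_mult_mat_vec simp: seidel_matrix_mult_vec_nth[OF H vs])
    ultimately show "main_seidel_eigenvalue H vs x"
      unfolding main_seidel_eigenvalue_def eigenvector_def
      using sum nz dim by (intro exI[of _ ?v]) auto
  }
qed

section \<open>The Seidel operator of a hyperstar\<close>

definition hyperstar_edge :: "nat \<Rightarrow> nat \<Rightarrow> (nat \<times> nat) set" where
  "hyperstar_edge k i = insert (0, 0) ({i} \<times> {1..<k})"

text \<open>This lets sums over the edges run over the index \<open>i\<close>. The vertex
  \<open>(i, 1)\<close>, present because \<open>k \<ge> 2\<close>, tells the edges apart.\<close>

lemma inj_on_hyperstar_edge:
  assumes "k \<ge> 2"
  shows "inj_on (hyperstar_edge k) A"
proof (rule inj_onI)
  fix i j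
  assume "hyperstar_edge k i = hyperstar_edge k j"
  moreover have "(i, 1) \<in> hyperstar_edge k i"
    using assms by (simp add: hyperstar_edge_def)
  ultimately have "(i, 1) \<in> hyperstar_edge k j"
    by simp
  then show "i = j"
    by (simp add: hyperstar_edge_def)
qed

lemma sum_verts_hyperstar:
  fixes f :: "nat \<times> nat \<Rightarrow> real"
  shows "(\<Sum>u\<in>verts (hyperstar n k). f u) = f (0, 0) + (\<Sum>i=1..<n. \<Sum>j=1..<k. f (i, j))"
  by (simp add: hyperstar_def sum.cartesian_product)

lemma sum_hyperstar_edge:
  fixes f :: "nat \<times> nat \<Rightarrow> real"
  shows "(\<Sum>w\<in>hyperstar_edge k i. f w) = f (0, 0) + (\<Sum>j=1..<k. f (i, j))"
proof -
  have "(\<Sum>w\<in>{i} \<times> {1..<k}. f w) = (\<Sum>j=1..<k. f (i, j))"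
    by (simp add: sum.cartesian_product[symmetric, of "\<lambda>i j. f (i, j)", simplified])
  then show ?thesis
    by (simp add: hyperstar_edge_def)
qed

text \<open>All edges contain the centre and together cover every other vertex once, so with
  \<open>a\<close> and \<open>B\<close> as above the value is
  \<open>(a + B) - a - 2 * B\<close>.\<close>

lemma seidel_operator_hyperstar_centre:
  assumes "k \<ge> 2"
  shows "seidel_operator (hyperstar n k) f (0, 0) = - (\<Sum>i=1..<n. \<Sum>j=1..<k. f (i, j))"
proof -
  have "{e \<in> edges (hyperstar n k). (0, 0) \<in> e} = hyperstar_edge k ` {1..<n}"
    by (auto simp: hyperstar_def hyperstar_edge_def)
  then have "(\<Sum>e | e \<in> edges (hyperstar n k) \<and> (0, 0) \<in> e. (\<Sum>w\<in>e. f w) - f (0, 0))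
    = (\<Sum>i=1..<n. (\<Sum>w\<in>hyperstar_edge k i. f w) - f (0, 0))"
    using sum.reindex[OF inj_on_hyperstar_edge[OF assms]] by simp
  also have "\<dots> = (\<Sum>i=1..<n. \<Sum>j=1..<k. f (i, j))"
    by (simp add: sum_hyperstar_edge)
  finally show ?thesis
    unfolding seidel_operator_def sum_verts_hyperstar by simp
qed

text \<open>Only the edge with index \<open>i\<close> contains \<open>(i, j)\<close>, so a single
  edge sum is subtracted twice.\<close>

lemma seidel_operator_hyperstar_leaf:
  assumes "i \<in> {1..<n}" and "j \<in> {1..<k}"
  shows "seidel_operator (hyperstar n k) f (i, j) =
    - f (0, 0) + (\<Sum>i=1..<n. \<Sum>j=1..<k. f (i, j)) - 2 * (\<Sum>j=1..<k. f (i, j)) + f (i, j)"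
proof -
  have "{e \<in> edges (hyperstar n k). (i, j) \<in> e} = {hyperstar_edge k i}"
    using assms by (auto simp: hyperstar_def hyperstar_edge_def)
  then show ?thesis
    unfolding seidel_operator_def sum_verts_hyperstar
    by (simp add: sum_hyperstar_edge)
qed

section \<open>Main eigenvalues of the hyperstar and the quadratic\<close>

lemma main_seidel_eigenvalue_hyperstar_iff:
  assumes n: "n \<ge> 3" and k: "k \<ge> 2" and vs: "enumerates vs (hyperstar n k)"
  shows "main_seidel_eigenvalue (hyperstar n k) vs x \<longleftrightarrow>
    x\<^sup>2 - ((real k - 1) * (real n - 3) + 1) * x - (real n - 1) * (real k - 1) = 0"
    (is "_ \<longleftrightarrow> x\<^sup>2 - ?c * x - ?d = 0")
proof
  let ?H = "hyperstar n k"
  have d: "?d > 0"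
    using n k by simp
  \<comment> \<open>The index intervals have \<open>n - 1\<close> and \<open>k - 1\<close> elements
    in truncated subtraction; the \<open>Suc 0\<close> variants match the simplifier's normal
    form.\<close>
  have [simp]: "real (n - 1) = real n - 1" "real (k - 1) = real k - 1"
    "real (n - Suc 0) = real n - 1" "real (k - Suc 0) = real k - 1"
    using n k by auto
  have verts: "verts ?H = insert (0, 0) ({1..<n} \<times> {1..<k})"
    by (simp add: hyperstar_def)
  note iff = main_seidel_eigenvalue_iff[OF finite_hypergraph_hyperstar vs]
  {
    assume "main_seidel_eigenvalue ?H vs x"
    then obtain f where f: "\<And>u. u \<in> verts ?H \<Longrightarrow> seidel_operator ?H f u = x * f u"
      and nz: "(\<Sum>u\<in>verts ?H. f u) \<noteq> 0"
      using iff by auto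
    define a where "a = f (0, 0)"
    define b where "b i = (\<Sum>j=1..<k. f (i, j))" for i
    define B where "B = (\<Sum>i=1..<n. b i)"
    have centre: "x * a = - B"
      using f[of "(0, 0)"] seidel_operator_hyperstar_centre[OF k, of n f]
      by (simp add: verts a_def B_def b_def)
    have leaf: "x * f (i, j) = - a + B - 2 * b i + f (i, j)"
      if "i \<in> {1..<n}" "j \<in> {1..<k}" for i j
      using f[of "(i, j)"] seidel_operator_hyperstar_leaf[OF that, of f] that
      by (simp add: verts a_def B_def b_def)
    have "x * B = (\<Sum>i=1..<n. \<Sum>j=1..<k. x * f (i, j))"
      by (simp add: B_def b_def sum_distrib_left)
    also have "\<dots> = (\<Sum>i=1..<n. \<Sum>j=1..<k. - a + B - 2 * b i + f (i, j))"
      using leaf by (intro sum.cong refl)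
    \<comment> \<open>In row \<open>i\<close> the coefficient of \<open>b i\<close> is
      \<open>1 - 2 * (k - 1)\<close>. After summing over \<open>i\<close>, that of \<open>B\<close>
      is \<open>(n - 1) * (k - 1) - (2 * k - 3) = (k - 1) * (n - 3) + 1\<close>.\<close>
    also have "\<dots> = (\<Sum>i=1..<n. (real k - 1) * (B - a) - (2 * real k - 3) * b i)"
    proof (rule sum.cong[OF refl])
      fix i
      have "(\<Sum>j=1..<k. - a + B - 2 * b i + f (i, j)) = (real k - 1) * (- a + B - 2 * b i) + b i"
        by (simp only: sum.distrib sum_constant b_def[symmetric]) simp
      then show "(\<Sum>j=1..<k. - a + B - 2 * b i + f (i, j))
        = (real k - 1) * (B - a) - (2 * real k - 3) * b i"
        by (simp only:) (simp add: algebra_simps)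
    qed
    also have "\<dots> = ?d * (B - a) - (2 * real k - 3) * B"
      by (simp add: sum_subtractf sum_distrib_left[symmetric] B_def)
    finally have leaves: "x * B = - ?d * a + ?c * B"
      by (simp add: algebra_simps)
    have "(x\<^sup>2 - ?c * x - ?d) * a = x * (x * a) - ?c * (x * a) - ?d * a"
      by (simp add: power2_eq_square algebra_simps)
    also have "\<dots> = 0"
      unfolding centre using leaves by (simp add: algebra_simps)
    finally have "(x\<^sup>2 - ?c * x - ?d) * a = 0" .
    moreover have "a \<noteq> 0"
      using nz centre unfolding sum_verts_hyperstar a_def B_def b_def by auto
    ultimately show "x\<^sup>2 - ?c * x - ?d = 0"
      by simp
  next
    assume root: "x\<^sup>2 - ?c * x - ?d = 0"
    \<comment> \<open>For a function with constant value \<open>t\<close> off the centre, the centre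
      row reads \<open>x * a = - ?d * t\<close>; taking \<open>t = x\<close> and
      \<open>a = - ?d\<close> solves it without division.\<close>
    define f :: "nat \<times> nat \<Rightarrow> real" where "f u = (if u = (0, 0) then - ?d else x)" for u
    have row: "(\<Sum>j=1..<k. f (i, j)) = (real k - 1) * x" if "i \<in> {1..<n}" for i
      using that by (simp add: f_def)
    have leaves: "(\<Sum>i=1..<n. \<Sum>j=1..<k. f (i, j)) = ?d * x"
      using row by simp
    have "seidel_operator ?H f u = x * f u" if u: "u \<in> verts ?H" for u
    proof (cases "u = (0, 0)")
      case True
      then show ?thesis
        using seidel_operator_hyperstar_centre[OF k, of n f] leaves by (simp add: f_def)
    next
      case False
      with u obtain i j where ij: "u = (i, j)" "i \<in> {1..<n}" "j \<in> {1..<k}"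
        unfolding verts by blast
      have "f (i, j) = x" "f (0, 0) = - ?d"
        using ij by (auto simp: f_def)
      \<comment> \<open>The row of a leaf becomes
        \<open>?d + (?d - 2 * (k - 1) + 1) * x = x * x\<close>, which is the quadratic because the
        bracket equals \<open>?c\<close>.\<close>
      then show ?thesis
        unfolding ij(1) seidel_operator_hyperstar_leaf[OF ij(2,3)] leaves row[OF ij(2)]
        using root by (simp add: power2_eq_square algebra_simps)
    qed
    moreover have "(\<Sum>u\<in>verts ?H. f u) \<noteq> 0"
    proof
      assume "(\<Sum>u\<in>verts ?H. f u) = 0"
      then have "?d * (x - 1) = 0"
        unfolding sum_verts_hyperstar leaves by (simp add: f_def algebra_simps)
      with d have "x = 1"
        by auto
      \<comment> \<open>At \<open>x = 1\<close> the quadratic has the value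
        \<open>- (k - 1) * (2 * n - 4)\<close>, which is nonzero since \<open>n \<ge> 3\<close> and
        \<open>k \<ge> 2\<close>; for \<open>n = 2\<close> it would vanish.\<close>
      with root have "(real k - 1) * (2 * real n - 4) = 0"
        by (simp add: algebra_simps)
      then show False
        using n k by auto
    qed
    ultimately show "main_seidel_eigenvalue ?H vs x"
      using iff by blast
  }
qed

text \<open>As \<open>d > 0\<close>, the discriminant \<open>c * c + 4 * d\<close> is positive; its
  square root \<open>s\<close> is then nonzero and separates the two roots.\<close>

lemma monic_quadratic_two_roots:
  fixes c d :: real
  assumes "d > 0"
  shows "\<exists>r1 r2. r1 \<noteq> r2 \<and> {x. x\<^sup>2 - c * x - d = 0} = {r1, r2}"
proof -
  define s where "s = sqrt (c\<^sup>2 + 4 * d)"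
  have pos: "c\<^sup>2 + 4 * d > 0"
    using assms by (simp add: add_nonneg_pos)
  then have s: "s > 0" "s\<^sup>2 = c\<^sup>2 + 4 * d"
    by (auto simp: s_def)
  have "x\<^sup>2 - c * x - d = (x - (c + s) / 2) * (x - (c - s) / 2)" for x
    using s(2) by (simp add: power2_eq_square field_simps)
  then have "{x. x\<^sup>2 - c * x - d = 0} = {(c + s) / 2, (c - s) / 2}"
    by auto
  with s(1) show ?thesis
    by (intro exI[of _ "(c + s) / 2"] exI[of _ "(c - s) / 2"]) auto
qed

theorem theorem4p7:
  fixes n k :: nat and vs :: "(nat \<times> nat) list"
  assumes "n \<ge> 3" and "k \<ge> 2"
    and "enumerates vs (hyperstar n k)"
  shows "\<exists>r1 r2 :: real. r1 \<noteq> r2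
    \<and> {x. x\<^sup>2 - ((real k - 1) * (real n - 3) + 1) * x - (real n - 1) * (real k - 1) = 0} = {r1, r2}
    \<and> {x. main_seidel_eigenvalue (hyperstar n k) vs x} = {r1, r2}"
proof -
  have "(real n - 1) * (real k - 1) > 0"
    using assms by simp
  from monic_quadratic_two_roots[OF this] show ?thesis
    unfolding main_seidel_eigenvalue_hyperstar_iff[OF assms] by simp
qed

end
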